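(* Let $g>0$, $\mu>e^g+e^{-g}$, $M=\{\mu,-\mu\}$, and let $H$ be the operator on $l^2(\mathbf Z)$ given by $(Hf)_m=e^{-g}f_{m-1}+e^{g}f_{m+1}+V_mf_m$, where $V$ is a $(\mathbf Z,M)$ pseudo-ergodic potential. Let $E=\{e^{g+i\theta}+e^{-g-i\theta}:\theta\in[0,2\pi]\}$. Then $$(\mathrm{Conv}(E)+\mu)\cup(\mathrm{Conv}(E)-\mu)\subseteq\mathrm{Spec}(H)\subseteq B(\mu,e^g+e^{-g})\cup B(-\mu,e^g+e^{-g})$$ and $$\mathrm{Spec}(H)\subseteq\mathrm{Conv}(E)+[-\mu,\mu].$$
   Context: A potential $V:\mathbf Z\to M$ is $(\mathbf Z,M)$ pseudo-ergodic if for every $\varepsilon>0$, every finite $F\subset\mathbf Z$ and every $W:F\to M$ there is $k\in\mathbf Z$ with $|W_m-V_{m+k}|<\varepsilon$ for all $m\in F$. $\mathrm{Conv}$ denotes the closed convex hull in $\mathbf C$, $B(x,r)=\{y\in\mathbf C:|x-y|\le r\}$, and sums of sets are Minkowski sums. *)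

theory Defs
  imports "HOL-Analysis.Analysis" "HOL-Library.Set_Algebras"
begin

definition l2Z :: "(int \<Rightarrow> complex) set" where
  "l2Z = {f. (\<lambda>m. (cmod (f m))\<^sup>2) summable_on UNIV}"

definition l2Z_norm :: "(int \<Rightarrow> complex) \<Rightarrow> real" where
  "l2Z_norm f = sqrt (\<Sum>\<^sub>\<infinity>m. (cmod (f m))\<^sup>2)"

text \<open>Operators on \<open>l2Z\<close> are functions on all sequences, but only their values on \<open>l2Z\<close> matter.\<close>

definition bounded_operator_l2Z :: "((int \<Rightarrow> complex) \<Rightarrow> (int \<Rightarrow> complex)) \<Rightarrow> bool" where
  "bounded_operator_l2Z T \<longleftrightarrow>
     (\<forall>f\<in>l2Z. T f \<in> l2Z) \<and>
     (\<forall>f\<in>l2Z. \<forall>h\<in>l2Z. T (\<lambda>m. f m + h m) = (\<lambda>m. T f m + T h m)) \<and>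
     (\<forall>c. \<forall>f\<in>l2Z. T (\<lambda>m. c * f m) = (\<lambda>m. c * T f m)) \<and>
     (\<exists>C. \<forall>f\<in>l2Z. l2Z_norm (T f) \<le> C * l2Z_norm f)"

text \<open>The spectrum is meant for operators satisfying \<open>bounded_operator_l2Z\<close>; the complement
  consists of those \<open>z\<close> for which \<open>T - z\<close> has a bounded two-sided inverse \<open>R\<close> on \<open>l2Z\<close>.\<close>

definition spectrum_l2Z :: "((int \<Rightarrow> complex) \<Rightarrow> (int \<Rightarrow> complex)) \<Rightarrow> complex set" where
  "spectrum_l2Z T = {z. \<not> (\<exists>R. bounded_operator_l2Z R \<and>
     (\<forall>f\<in>l2Z. R (\<lambda>m. T f m - z * f m) = f \<and> (\<lambda>m. T (R f) m - z * R f m) = f))}"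

definition pseudo_ergodic :: "complex set \<Rightarrow> (int \<Rightarrow> complex) \<Rightarrow> bool" where
  "pseudo_ergodic M V \<longleftrightarrow> range V \<subseteq> M \<and>
     (\<forall>\<epsilon>>0. \<forall>F W. finite F \<and> W ` F \<subseteq> M \<longrightarrow>
        (\<exists>k. \<forall>m\<in>F. cmod (W m - V (m + k)) < \<epsilon>))"

definition closed_convex_hull :: "complex set \<Rightarrow> complex set" where
  "closed_convex_hull S = closure (convex hull S)"

definition hopping_operator ::
    "real \<Rightarrow> (int \<Rightarrow> complex) \<Rightarrow> (int \<Rightarrow> complex) \<Rightarrow> (int \<Rightarrow> complex)" where
  "hopping_operator g V f =
     (\<lambda>m. of_real (exp (- g)) * f (m - 1) + of_real (exp g) * f (m + 1) + V m * f m)"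

definition hopping_ellipse :: "real \<Rightarrow> complex set" where
  "hopping_ellipse g =
     {exp (of_real g + \<i> * of_real \<theta>) + exp (- of_real g - \<i> * of_real \<theta>) |\<theta>. \<theta> \<in> {0..2 * pi}}"

end

theory Submission
  imports Defs
begin

text \<open>
  The lower inclusion comes from eigenvectors for a step potential. Write \<open>\<lambda> = u + 1 / u\<close>. The ellipse
  is the image of the circle \<open>\<bar>u\<bar> = e\<^sup>g\<close> under this map, and since \<open>\<lambda> \<plusminus> 2\<close> are the squares of
  \<open>s \<plusminus> 1 / s\<close> with \<open>s\<^sup>2 = u\<close>, the sum of the distances from \<open>\<lambda>\<close> to the foci \<open>\<plusminus> 2\<close> is
  \<open>2 (\<bar>u\<bar> + 1 / \<bar>u\<bar>)\<close>. The position of \<open>\<lambda>\<close> relative to the ellipse is therefore read off from \<open>\<bar>u\<bar>\<close>.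
  The equation \<open>H f = z f\<close> with constant potential \<open>\<nu>\<close> has the characteristic roots \<open>e\<^bsup>-g\<^esup> u\<close> and
  \<open>e\<^bsup>-g\<^esup> / u\<close>, where \<open>u + 1 / u = z - \<nu>\<close>. If \<open>z - \<nu>\<close> is inside the ellipse, both roots have modulus below
  \<open>1\<close>, so every solution on the right half-line decays. If \<open>z + \<nu>\<close> is far outside, the equation with
  potential \<open>-\<nu>\<close> has a root of modulus above \<open>1\<close>, hence a solution that decays on the left half-line. As all
  solutions decay on the right, this one can be continued there, and it becomes an eigenvector for the
  potential \<open>\<nu>\<close> on \<open>m \<ge> 0\<close>, \<open>-\<nu>\<close> on \<open>m < 0\<close>. Its truncations, translated to a place
  where a pseudo-ergodic potential repeats a long piece of that step, are approximate eigenvectors of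
  the given operator. Points on the ellipse itself are reached by shrinking towards the centre.
  The lemmas are \<open>decaying_solution\<close>, \<open>truncated_eigenvector\<close> and
  \<open>shifted_hull_subset_hopping_spectrum\<close>.

  Both upper inclusions exhibit a nowhere vanishing bounded sequence \<open>p\<close> for which \<open>1 - p (H - z)\<close> is a
  strict contraction; a Neumann series then inverts \<open>H - z\<close>
  (\<open>preconditioned_contraction_not_in_spectrum\<close>). For the discs, \<open>p = 1 / (V - z)\<close> works because the
  hopping part has norm at most \<open>e\<^sup>g + e\<^bsup>-g\<^esup>\<close>. For the convex set, a point outside it is separated
  from it by a line. That line also bounds the numerical range, so that \<open>Re \<langle>c (H - z) f, f\<rangle> \<ge> \<delta> \<parallel>f\<parallel>\<^sup>2\<close> for
  a normal \<open>c\<close>, and the constant sequence \<open>p = \<tau> c\<close> works for small \<open>\<tau> > 0\<close>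
  (\<open>hopping_half_plane_not_in_spectrum\<close>).
\<close>

section \<open>Square-summable sequences\<close>

text \<open>The norm is the supremum of the norms of finite pieces. Membership and norm bounds are
  inherited in this way from the Euclidean norm on finite index sets.\<close>

lemma l2Z_boundedI:
  assumes "\<And>F. finite F \<Longrightarrow> L2_set (\<lambda>m. cmod (f m)) F \<le> C"
  shows "f \<in> l2Z" and "l2Z_norm f \<le> C"
proof -
  have C: "0 \<le> C" using assms[of "{}"] by simp
  have le: "(\<Sum>m\<in>F. (cmod (f m))\<^sup>2) \<le> C\<^sup>2" if "finite F" for F
    using assms[OF that] by (simp add: L2_set_def sqrt_le_D)
  have "(\<lambda>m. (cmod (f m))\<^sup>2) summable_on UNIV"
    by (rule nonneg_bdd_above_summable_on) (auto intro!: bdd_aboveI2 le)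
  then show "f \<in> l2Z" by (simp add: l2Z_def)
  then have "(\<Sum>\<^sub>\<infinity>m. (cmod (f m))\<^sup>2) \<le> C\<^sup>2"
    unfolding l2Z_def by (auto intro!: infsum_le_finite_sums le)
  then show "l2Z_norm f \<le> C"
    unfolding l2Z_norm_def using C by (simp add: real_le_lsqrt)
qed

lemma L2_set_le_l2Z_norm:
  assumes "f \<in> l2Z" "finite F"
  shows "L2_set (\<lambda>m. cmod (f m)) F \<le> l2Z_norm f"
  using assms unfolding L2_set_def l2Z_norm_def l2Z_def
  by (auto intro!: real_sqrt_le_mono finite_sum_le_infsum)

lemma norm_le_l2Z_norm: "f \<in> l2Z \<Longrightarrow> cmod (f m) \<le> l2Z_norm f"
  using L2_set_le_l2Z_norm[of f "{m}"] by simp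

lemma l2Z_norm_nonneg: "0 \<le> l2Z_norm f"
  by (simp add: l2Z_norm_def infsum_nonneg)

lemma l2Z_zero: "(\<lambda>m. 0) \<in> l2Z" "l2Z_norm (\<lambda>m. 0) = 0"
  by (simp_all add: l2Z_def l2Z_norm_def)

lemma l2Z_norm_eq_0: "f \<in> l2Z \<Longrightarrow> l2Z_norm f \<le> 0 \<Longrightarrow> f m = 0"
  using norm_le_l2Z_norm[of f m] by (metis norm_le_zero_iff order_trans)

lemma has_sum_l2Z_norm:
  "f \<in> l2Z \<Longrightarrow> ((\<lambda>m. (cmod (f m))\<^sup>2) has_sum (l2Z_norm f)\<^sup>2) UNIV"
  by (simp add: l2Z_def l2Z_norm_def infsum_nonneg)

lemma l2Z_add:
  assumes "f \<in> l2Z" "h \<in> l2Z"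
  shows "(\<lambda>m. f m + h m) \<in> l2Z" and "l2Z_norm (\<lambda>m. f m + h m) \<le> l2Z_norm f + l2Z_norm h"
proof -
  have "L2_set (\<lambda>m. cmod (f m + h m)) F \<le> l2Z_norm f + l2Z_norm h" if "finite F" for F
  proof -
    have "L2_set (\<lambda>m. cmod (f m + h m)) F \<le> L2_set (\<lambda>m. cmod (f m) + cmod (h m)) F"
      by (intro L2_set_mono norm_triangle_ineq) auto
    also have "\<dots> \<le> L2_set (\<lambda>m. cmod (f m)) F + L2_set (\<lambda>m. cmod (h m)) F"
      by (rule L2_set_triangle_ineq)
    also have "\<dots> \<le> l2Z_norm f + l2Z_norm h"
      by (intro add_mono L2_set_le_l2Z_norm assms that)
    finally show ?thesis .
  qed
  from l2Z_boundedI[OF this]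
  show "(\<lambda>m. f m + h m) \<in> l2Z" "l2Z_norm (\<lambda>m. f m + h m) \<le> l2Z_norm f + l2Z_norm h"
    by blast+
qed

lemma l2Z_mult_bounded:
  assumes "f \<in> l2Z" "\<And>m. cmod (p m) \<le> P"
  shows "(\<lambda>m. p m * f m) \<in> l2Z" and "l2Z_norm (\<lambda>m. p m * f m) \<le> P * l2Z_norm f"
proof -
  have P: "0 \<le> P" using assms(2)[of 0] norm_ge_zero order_trans by blast
  have "L2_set (\<lambda>m. cmod (p m * f m)) F \<le> P * l2Z_norm f" if "finite F" for F
  proof -
    have "L2_set (\<lambda>m. cmod (p m * f m)) F \<le> L2_set (\<lambda>m. P * cmod (f m)) F"
      by (intro L2_set_mono) (auto simp: norm_mult intro!: mult_right_mono assms)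
    also have "\<dots> = P * L2_set (\<lambda>m. cmod (f m)) F"
      using P by (simp add: L2_set_right_distrib)
    also have "\<dots> \<le> P * l2Z_norm f"
      by (intro mult_left_mono L2_set_le_l2Z_norm assms that P)
    finally show ?thesis .
  qed
  from l2Z_boundedI[OF this]
  show "(\<lambda>m. p m * f m) \<in> l2Z" "l2Z_norm (\<lambda>m. p m * f m) \<le> P * l2Z_norm f"
    by blast+
qed

lemmas l2Z_scale = l2Z_mult_bounded[where p = "\<lambda>_. c" and P = "cmod c" for c, OF _ order_refl]

lemma l2Z_diff_scaled: "f \<in> l2Z \<Longrightarrow> h \<in> l2Z \<Longrightarrow> (\<lambda>m. h m - z * f m) \<in> l2Z"
  using l2Z_add(1)[OF _ l2Z_scale(1), of h f "- z"] by simp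

lemma bij_int_shift: "bij (\<lambda>m. m + k)" for k :: int
  by (rule bijI') (auto intro: exI[of _ "_ - k"])

lemma l2Z_shift:
  "(\<lambda>m. f (m + k)) \<in> l2Z \<longleftrightarrow> f \<in> l2Z"
  "l2Z_norm (\<lambda>m. f (m + k)) = l2Z_norm f"
  using summable_on_reindex_bij_betw[OF bij_int_shift, of "\<lambda>m. (cmod (f m))\<^sup>2" k]
    infsum_reindex_bij_betw[OF bij_int_shift, of "\<lambda>m. (cmod (f m))\<^sup>2" k]
  by (simp_all add: l2Z_def l2Z_norm_def)

text \<open>On finite pieces the norm passes to the limit. The sum of the Neumann series below is square-summable
  for this reason.\<close>

lemma l2Z_pointwise_limit:
  assumes F: "\<And>n. F n \<in> l2Z" "\<And>n. l2Z_norm (F n) \<le> C"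
    and lim: "\<And>m. (\<lambda>n. F n m) \<longlonglongrightarrow> f m"
  shows "f \<in> l2Z"
proof (rule l2Z_boundedI)
  fix S :: "int set" assume S: "finite S"
  have "(\<lambda>n. L2_set (\<lambda>m. cmod (F n m)) S) \<longlonglongrightarrow> L2_set (\<lambda>m. cmod (f m)) S"
    unfolding L2_set_def by (intro tendsto_intros lim)
  then show "L2_set (\<lambda>m. cmod (f m)) S \<le> C"
    by (rule LIMSEQ_le_const2) (use L2_set_le_l2Z_norm[OF F(1) S] F(2) order_trans in blast)
qed

section \<open>Criteria for the spectrum\<close>

text \<open>With \<open>L = p (T - z)\<close> and \<open>Q = 1 - L\<close>, the equation \<open>L f = h\<close> is solved by the Neumann series
  \<open>f = \<Sum> Q\<^sup>n h\<close>. The series converges geometrically in every coordinate, and continuity of \<open>T\<close> with respect to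
  coordinatewise convergence suffices to identify its sum as a solution. Multiplication by \<open>p\<close> is injective, so
  \<open>L f = p h\<close> amounts to \<open>(T - z) f = h\<close>.\<close>

lemma preconditioned_contraction_not_in_spectrum:
  fixes p :: "int \<Rightarrow> complex"
  assumes maps: "\<And>f. f \<in> l2Z \<Longrightarrow> T f \<in> l2Z"
    and add: "\<And>f h. T (\<lambda>m. f m + h m) = (\<lambda>m. T f m + T h m)"
    and scale: "\<And>c f. T (\<lambda>m. c * f m) = (\<lambda>m. c * T f m)"
    and cont: "\<And>F f m. (\<And>j. (\<lambda>n. F n j) \<longlonglongrightarrow> f j) \<Longrightarrow> (\<lambda>n. T (F n) m) \<longlonglongrightarrow> T f m"
    and p: "\<And>m. p m \<noteq> 0" "\<And>m. cmod (p m) \<le> P"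
    and q: "0 \<le> q" "q < 1"
    and contr: "\<And>f. f \<in> l2Z \<Longrightarrow> l2Z_norm (\<lambda>m. f m - p m * (T f m - z * f m)) \<le> q * l2Z_norm f"
  shows "z \<notin> spectrum_l2Z T"
proof -
  have T0: "T (\<lambda>m. 0) = (\<lambda>m. 0)" using scale[of 0] by simp
  define L where "L f = (\<lambda>m. p m * (T f m - z * f m))" for f
  define Q where "Q f = (\<lambda>m. f m - L f m)" for f
  have L_l2: "L f \<in> l2Z" if "f \<in> l2Z" for f
    unfolding L_def by (intro l2Z_mult_bounded(1)[OF _ p(2)] l2Z_diff_scaled that maps)
  have Q_l2: "Q f \<in> l2Z" if "f \<in> l2Z" for f
    using l2Z_diff_scaled[OF L_l2[OF that] that, of 1] by (simp add: Q_def)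
  have Q_norm: "l2Z_norm (Q f) \<le> q * l2Z_norm f" if "f \<in> l2Z" for f
    using contr[OF that] by (simp add: Q_def L_def)
  have L_add: "L (\<lambda>m. f m + h m) = (\<lambda>m. L f m + L h m)" for f h
    by (simp add: L_def add algebra_simps)
  have L_scale: "L (\<lambda>m. c * f m) = (\<lambda>m. c * L f m)" for c f
    by (simp add: L_def scale algebra_simps)
  have solves_iff: "(\<lambda>m. T f m - z * f m) = h \<longleftrightarrow> L f = (\<lambda>m. p m * h m)" for f h
    by (auto simp: L_def fun_eq_iff p)
  have unique: "f = h" if "f \<in> l2Z" "h \<in> l2Z" "L f = L h" for f h
  proof -
    define d where "d m = f m + (-1) * h m" for m
    have d: "d \<in> l2Z" unfolding d_def by (intro l2Z_add l2Z_scale that)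
    have "L d = (\<lambda>m. 0)" unfolding d_def L_add L_scale that by simp
    then have "l2Z_norm d \<le> q * l2Z_norm d" using Q_norm[OF d] by (simp add: Q_def)
    then have "(1 - q) * l2Z_norm d \<le> 0" by (simp add: algebra_simps)
    then have "l2Z_norm d \<le> 0" using q by (simp add: mult_le_0_iff)
    then have "d m = 0" for m using l2Z_norm_eq_0[OF d] by blast
    then show ?thesis by (auto simp: d_def)
  qed
  have bound: "l2Z_norm f \<le> l2Z_norm (L f) / (1 - q)" if f: "f \<in> l2Z" for f
  proof -
    have "f = (\<lambda>m. Q f m + L f m)" by (simp add: Q_def)
    then have "l2Z_norm f \<le> l2Z_norm (Q f) + l2Z_norm (L f)"
      using l2Z_add(2)[OF Q_l2[OF f] L_l2[OF f]] by simp
    also have "\<dots> \<le> q * l2Z_norm f + l2Z_norm (L f)" using Q_norm[OF f] by simp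
    finally show ?thesis using q by (simp add: field_simps)
  qed
  have surj: "\<exists>f\<in>l2Z. L f = h" if h: "h \<in> l2Z" for h
  proof -
    define D where "D n = (Q ^^ n) h" for n
    define F where "F n = (\<lambda>m. \<Sum>k<n. D k m)" for n
    define N where "N = l2Z_norm h"
    have D_l2: "D n \<in> l2Z" for n by (induction n) (auto simp: D_def h Q_l2)
    have D_norm: "l2Z_norm (D n) \<le> q ^ n * N" for n
    proof (induction n)
      case (Suc n)
      have "l2Z_norm (D (Suc n)) \<le> q * l2Z_norm (D n)" using Q_norm[OF D_l2[of n]] by (simp add: D_def)
      also have "\<dots> \<le> q * (q ^ n * N)" using Suc q by (intro mult_left_mono)
      finally show ?case by simp
    qed (simp add: D_def N_def)
    have F_Suc: "F (Suc n) = (\<lambda>m. F n m + D n m)" for n by (simp add: F_def)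
    have F_l2: "F n \<in> l2Z \<and> l2Z_norm (F n) \<le> (\<Sum>k<n. q ^ k * N)" for n
    proof (induction n)
      case (Suc n)
      then show ?case using l2Z_add[of "F n" "D n"] D_l2[of n] D_norm[of n]
        unfolding F_Suc by auto
    qed (simp add: F_def l2Z_zero)
    have geom: "summable (\<lambda>k. q ^ k * N)" using q by (intro summable_mult2 summable_geometric) simp
    have F_bound: "l2Z_norm (F n) \<le> (\<Sum>k. q ^ k * N)" for n
      using F_l2[of n] sum_le_suminf[OF geom, of "{..<n}"] q l2Z_norm_nonneg[of h]
      by (force simp: N_def)
    have D_le: "cmod (D n m) \<le> q ^ n * N" for n m
      using norm_le_l2Z_norm[OF D_l2] D_norm order_trans by blast
    define f where "f m = (\<Sum>k. D k m)" for m
    have F_lim: "(\<lambda>n. F n m) \<longlonglongrightarrow> f m" for m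
      unfolding F_def f_def
      by (intro summable_LIMSEQ summable_comparison_test[OF _ geom]) (use D_le in auto)
    have f: "f \<in> l2Z" using l2Z_pointwise_limit[of F, OF _ F_bound F_lim] F_l2 by blast
    have telescope: "L (F n) m = h m - D n m" for n m
    proof (induction n)
      case 0
      then show ?case by (simp add: F_def D_def L_def T0)
    next
      case (Suc n)
      have "D (Suc n) m = D n m - L (D n) m" by (simp add: D_def Q_def)
      then show ?case unfolding F_Suc L_add using Suc by simp
    qed
    have "L f m = h m" for m
    proof (rule LIMSEQ_unique)
      show "(\<lambda>n. L (F n) m) \<longlonglongrightarrow> L f m"
        unfolding L_def by (intro tendsto_intros cont F_lim)
      have "(\<lambda>n. D n m) \<longlonglongrightarrow> 0"
        by (rule Lim_null_comparison[OF _ summable_LIMSEQ_zero[OF geom]]) (simp add: D_le)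
      then have "(\<lambda>n. h m - D n m) \<longlonglongrightarrow> h m - 0" by (intro tendsto_intros)
      then show "(\<lambda>n. L (F n) m) \<longlonglongrightarrow> h m" by (simp add: telescope)
    qed
    then have "L f = h" by (rule ext)
    with f show ?thesis by (intro bexI)
  qed
  define R where "R h = (SOME f. f \<in> l2Z \<and> L f = (\<lambda>m. p m * h m))" for h
  have R: "R h \<in> l2Z \<and> L (R h) = (\<lambda>m. p m * h m)" if "h \<in> l2Z" for h
    unfolding R_def using surj[OF l2Z_mult_bounded(1)[of h p, OF that p(2)]] by (intro someI_ex[of "\<lambda>f. f \<in> l2Z \<and> L f = (\<lambda>m. p m * h m)"]) (simp add: Bex_def)
  have R_eq: "R h = f" if "h \<in> l2Z" "f \<in> l2Z" "L f = (\<lambda>m. p m * h m)" for f h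
    by (rule unique) (use R[OF that(1)] that in simp_all)
  have "bounded_operator_l2Z R"
    unfolding bounded_operator_l2Z_def
  proof (intro conjI ballI allI exI)
    show "R f \<in> l2Z" if "f \<in> l2Z" for f using R that by blast
    show "R (\<lambda>m. f m + h m) = (\<lambda>m. R f m + R h m)" if "f \<in> l2Z" "h \<in> l2Z" for f h
      by (rule R_eq) (simp_all add: that R L_add l2Z_add distrib_left)
    show "R (\<lambda>m. c * f m) = (\<lambda>m. c * R f m)" if "f \<in> l2Z" for c f
      by (rule R_eq) (simp_all add: that R L_scale l2Z_scale mult.left_commute)
    show "l2Z_norm (R f) \<le> P / (1 - q) * l2Z_norm f" if "f \<in> l2Z" for f
    proof -
      have "l2Z_norm (R f) \<le> l2Z_norm (\<lambda>m. p m * f m) / (1 - q)"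
        using bound[of "R f"] R[OF that] by simp
      also have "\<dots> \<le> (P * l2Z_norm f) / (1 - q)"
        using q by (intro divide_right_mono l2Z_mult_bounded that p) auto
      finally show ?thesis by simp
    qed
  qed
  moreover have "R (\<lambda>m. T f m - z * f m) = f \<and> (\<lambda>m. T (R f) m - z * R f m) = f" if f: "f \<in> l2Z" for f
  proof
    have "(\<lambda>m. T f m - z * f m) \<in> l2Z"
      by (intro l2Z_diff_scaled f maps)
    then show "R (\<lambda>m. T f m - z * f m) = f" by (rule R_eq) (simp_all add: f L_def)
    show "(\<lambda>m. T (R f) m - z * R f m) = f" by (rule solves_iff[THEN iffD2]) (simp add: R f)
  qed
  ultimately show ?thesis unfolding spectrum_l2Z_def mem_Collect_eq not_not
    by (intro exI[of _ R] conjI ballI) auto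
qed

text \<open>An inverse of \<open>T - z\<close> bounded by \<open>C\<close> would force \<open>\<parallel>f\<parallel> \<le> C \<epsilon> \<parallel>f\<parallel>\<close> for a nonzero \<open>f\<close> and every \<open>\<epsilon> > 0\<close>.\<close>

lemma approximate_eigenvectors_in_spectrum:
  assumes "\<And>\<epsilon>. \<epsilon> > 0 \<Longrightarrow> \<exists>f\<in>l2Z. l2Z_norm f > 0 \<and>
      (\<lambda>m. T f m - z * f m) \<in> l2Z \<and> l2Z_norm (\<lambda>m. T f m - z * f m) \<le> \<epsilon> * l2Z_norm f"
  shows "z \<in> spectrum_l2Z T"
proof (rule ccontr)
  assume "z \<notin> spectrum_l2Z T"
  then obtain R where R: "bounded_operator_l2Z R"
      and inv: "\<And>f. f \<in> l2Z \<Longrightarrow> R (\<lambda>m. T f m - z * f m) = f"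
    by (auto simp: spectrum_l2Z_def)
  from R obtain C where C: "\<And>f. f \<in> l2Z \<Longrightarrow> l2Z_norm (R f) \<le> C * l2Z_norm f"
    unfolding bounded_operator_l2Z_def by blast
  define \<epsilon> where "\<epsilon> = 1 / (2 * (\<bar>C\<bar> + 1))"
  have "\<epsilon> > 0" by (simp add: \<epsilon>_def)
  then obtain f where f: "f \<in> l2Z" "l2Z_norm f > 0" "(\<lambda>m. T f m - z * f m) \<in> l2Z"
      "l2Z_norm (\<lambda>m. T f m - z * f m) \<le> \<epsilon> * l2Z_norm f"
    using assms by blast
  have "l2Z_norm f = l2Z_norm (R (\<lambda>m. T f m - z * f m))" using f inv by simp
  also have "\<dots> \<le> C * l2Z_norm (\<lambda>m. T f m - z * f m)" by (intro C f)
  also have "\<dots> \<le> (\<bar>C\<bar> + 1) * (\<epsilon> * l2Z_norm f)" by (intro mult_mono f l2Z_norm_nonneg) auto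
  also have "\<dots> = l2Z_norm f / 2" by (simp add: \<epsilon>_def field_simps)
  finally show False using f(2) by simp
qed

section \<open>The Joukowski map and the ellipse\<close>

text \<open>The preimages of a point are \<open>u\<close> and \<open>1 / u\<close>, so one of them lies outside the open unit disc.\<close>

lemma joukowski_surj:
  fixes a :: complex
  obtains u where "u \<noteq> 0" "u + 1 / u = a" "cmod u \<ge> 1"
proof -
  define w where "w = (a + csqrt (a\<^sup>2 - 4)) / 2"
  have eq: "w * (a - w) = 1"
  proof -
    have "4 * (w * (a - w)) = a\<^sup>2 - (csqrt (a\<^sup>2 - 4))\<^sup>2"
      unfolding w_def by (simp add: field_simps power2_eq_square)
    also have "\<dots> = 4" by simp
    finally show ?thesis by simp
  qed
  then have w: "w \<noteq> 0" by auto
  then have w_inv: "1 / w = a - w" using eq by (simp add: divide_eq_eq mult.commute)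
  show thesis
  proof (cases "cmod w \<ge> 1")
    case True
    then show ?thesis using that[of w] w w_inv by simp
  next
    case False
    then have "cmod (1 / w) \<ge> 1" using w by (simp add: norm_divide)
    moreover from eq have "a - w \<noteq> 0" "1 / (a - w) = w" by (auto simp: divide_eq_eq)
    ultimately show ?thesis using that[of "a - w"] w_inv by simp
  qed
qed

text \<open>If \<open>s\<^sup>2 = u\<close>, then \<open>u + 1 / u \<plusminus> 2 = (s \<plusminus> 1 / s)\<^sup>2\<close>, and the identity is the
  parallelogram law for \<open>s\<close> and \<open>1 / s\<close>.\<close>

lemma joukowski_foci:
  fixes u :: complex
  assumes "u \<noteq> 0"
  shows "cmod (u + 1 / u - 2) + cmod (u + 1 / u + 2) = 2 * (cmod u + 1 / cmod u)"
proof -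
  define s where "s = csqrt u"
  have s: "s\<^sup>2 = u" "s \<noteq> 0" using assms by (auto simp: s_def)
  have "u + 1 / u - 2 = (s - 1 / s)\<^sup>2" "u + 1 / u + 2 = (s + 1 / s)\<^sup>2"
    using s(2) unfolding s(1)[symmetric] by (simp_all add: field_simps power2_eq_square)
  then have "cmod (u + 1 / u - 2) + cmod (u + 1 / u + 2) = (cmod (s - 1 / s))\<^sup>2 + (cmod (s + 1 / s))\<^sup>2"
    by (simp add: norm_power)
  also have "\<dots> = 2 * (cmod s)\<^sup>2 + 2 * (cmod (1 / s))\<^sup>2"
    unfolding cmod_power2 by (simp add: power2_eq_square algebra_simps)
  also have "\<dots> = 2 * (cmod u + 1 / cmod u)"
    unfolding s(1)[symmetric] by (simp add: norm_divide norm_power power_divide)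
  finally show ?thesis .
qed

lemma add_inverse_less_iff:
  fixes t k :: real
  assumes "1 \<le> t" "1 < k"
  shows "t + 1 / t < k + 1 / k \<longleftrightarrow> t < k"
proof -
  have "1 * 1 < t * k" using assms by (intro mult_le_less_imp_less) auto
  then have pos: "(t * k - 1) / (t * k) > 0" by simp
  have "k + 1 / k - (t + 1 / t) = (k - t) * ((t * k - 1) / (t * k))"
    using assms by (simp add: field_simps)
  with pos have "0 < k + 1 / k - (t + 1 / t) \<longleftrightarrow> 0 < k - t"
    by (simp only: zero_less_mult_iff) (meson less_asym)
  then show ?thesis by (simp only: diff_gt_0_iff_gt)
qed

lemma hopping_ellipse_eq_joukowski_image:
  "hopping_ellipse g = (\<lambda>u. u + 1 / u) ` {u. cmod u = exp g}"
proof -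
  define e where "e \<theta> = exp (complex_of_real g + \<i> * complex_of_real \<theta>)" for \<theta>
  have "u \<in> e ` {0..2 * pi}" if "cmod u = exp g" for u
  proof
    have "u = of_real (exp g) * exp (\<i> * of_real (Arg2pi u))"
      using Arg2pi_eq[of u] that by simp
    then show "u = e (Arg2pi u)" by (simp add: e_def exp_add exp_of_real)
  qed (use Arg2pi[of u] in auto)
  moreover have "cmod (e \<theta>) = exp g" for \<theta> by (simp add: e_def)
  ultimately have circle: "{u. cmod u = exp g} = e ` {0..2 * pi}" by auto
  have "exp (- of_real g - \<i> * of_real \<theta>) = 1 / e \<theta>" for \<theta>
  proof -
    have "- of_real g - \<i> * of_real \<theta> = - (of_real g + \<i> * of_real \<theta> :: complex)" by simp
    then show ?thesis unfolding e_def by (simp only: exp_minus inverse_eq_divide)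
  qed
  then have "hopping_ellipse g = {e \<theta> + 1 / e \<theta> |\<theta>. \<theta> \<in> {0..2 * pi}}"
    by (simp only: hopping_ellipse_def flip: e_def)
  then show ?thesis unfolding circle by (simp only: Setcompr_eq_image image_image)
qed

text \<open>The sum of the distances to two fixed points is a continuous convex function, so its sublevel set
  is closed and convex and contains the hull as soon as it contains the ellipse.\<close>

lemma closed_convex_hull_ellipse_foci:
  assumes "w \<in> closed_convex_hull (hopping_ellipse g)"
  shows "cmod (w - 2) + cmod (w + 2) \<le> 2 * (exp g + exp (- g))"
proof -
  let ?S = "{w. cmod (w - 2) + cmod (w + 2) \<le> 2 * (exp g + exp (- g))}"
  have foci_dist: "dist 2 w + dist (- 2) w = cmod (w - 2) + cmod (w + 2)" for w :: complex
    by (metis dist_commute dist_norm diff_minus_eq_add)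
  have "convex_on UNIV (\<lambda>w :: complex. dist 2 w + dist (- 2) w)"
    by (intro convex_on_add convex_on_dist) auto
  note lower = convex_lower[OF this, unfolded foci_dist]
  have "convex ?S"
  proof (rule convexI)
    fix x y :: complex and u v :: real
    assume "x \<in> ?S" "y \<in> ?S" "0 \<le> u" "0 \<le> v" "u + v = 1"
    then show "u *\<^sub>R x + v *\<^sub>R y \<in> ?S"
      using lower[of x y u v] by simp
  qed
  moreover have "closed ?S" by (intro closed_Collect_le continuous_intros)
  moreover have "hopping_ellipse g \<subseteq> ?S"
    unfolding hopping_ellipse_eq_joukowski_image
  proof clarify
    fix u assume u: "cmod u = exp g"
    then have "u \<noteq> 0" by auto
    from joukowski_foci[OF this] u
    show "cmod (u + 1 / u - 2) + cmod (u + 1 / u + 2) \<le> 2 * (exp g + exp (- g))"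
      by (simp add: exp_minus inverse_eq_divide)
  qed
  ultimately have "closed_convex_hull (hopping_ellipse g) \<subseteq> ?S"
    unfolding closed_convex_hull_def by (intro closure_minimal hull_minimal)
  with assms show ?thesis by auto
qed

section \<open>Eigenvectors for a step potential\<close>

text \<open>The difference \<open>s (n + 1) - x s n\<close> is a geometric sequence with ratio \<open>y\<close>. Solving this first-order
  recursion treats distinct and coinciding roots alike, at the price of a polynomial factor in
  the bound \<open>C (n + 1) r\<^sup>n\<close>.\<close>

lemma second_order_recurrence_tendsto_0:
  fixes x y a b :: complex
  assumes "cmod x < 1" "cmod y < 1"
  obtains s :: "nat \<Rightarrow> complex" where "s 0 = a" "s 1 = b"
    "\<And>n. s (n + 2) = (x + y) * s (n + 1) - x * y * s n" "s \<longlonglongrightarrow> 0"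
proof -
  define c where "c = b - x * a"
  define s where "s = rec_nat a (\<lambda>n v. x * v + c * y ^ n)"
  have s: "s 0 = a" "\<And>n. s (Suc n) = x * s n + c * y ^ n" by (simp_all add: s_def)
  have "s (n + 2) = (x + y) * s (n + 1) - x * y * s n" for n
    by (simp add: s algebra_simps)
  moreover have "s 1 = b" by (simp add: s c_def)
  moreover have "s \<longlonglongrightarrow> 0"
  proof -
    define r where "r = max (max (cmod x) (cmod y)) (1/2)"
    have r: "cmod x \<le> r" "cmod y \<le> r" "0 < r" "r < 1" using assms by (auto simp: r_def)
    define C where "C = max (cmod a) (cmod c / r)"
    have C: "cmod a \<le> C" "cmod c \<le> C * r" "0 \<le> C"
      using r by (auto simp: C_def le_max_iff_disj field_simps max_def)
    have bound: "cmod (s n) \<le> C * (real n + 1) * r ^ n" for n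
    proof (induction n)
      case (Suc n)
      have "cmod (s (Suc n)) \<le> cmod x * cmod (s n) + cmod c * cmod y ^ n"
        using norm_triangle_ineq[of "x * s n" "c * y ^ n"] by (simp add: s norm_mult norm_power)
      also have "\<dots> \<le> r * (C * (real n + 1) * r ^ n) + (C * r) * r ^ n"
        using r C by (intro add_mono mult_mono power_mono Suc) auto
      also have "\<dots> = C * (real (Suc n) + 1) * r ^ Suc n" by (simp add: algebra_simps)
      finally show ?case .
    qed (simp add: s C)
    have "(\<lambda>n. C * (real n * r ^ n + r ^ n)) \<longlonglongrightarrow> C * (0 + 0)"
      using powser_times_n_limit_0[of r] r by (intro tendsto_intros LIMSEQ_power_zero) auto
    then have "(\<lambda>n. C * (real n + 1) * r ^ n) \<longlonglongrightarrow> 0" by (simp add: algebra_simps)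
    then show ?thesis by (rule Lim_null_comparison[rotated]) (simp add: bound)
  qed
  ultimately show thesis using that s(1) by blast
qed

text \<open>On the left the solution is a single power \<open>y\<^bsup>-m\<^esup>\<close> with \<open>\<bar>y\<bar> < 1\<close>; on the right it
  is the continuation of the values at \<open>-1\<close> and \<open>0\<close>, which decays because both characteristic
  roots lie in the open unit disc.\<close>

lemma decaying_solution:
  fixes g :: real and z \<nu> :: complex
  assumes g: "g > 0"
    and inside: "cmod (z - \<nu> - 2) + cmod (z - \<nu> + 2) < 2 * (exp g + exp (- g))"
    and outside: "cmod (z + \<nu>) > exp g + exp (- g)"
  obtains F :: "int \<Rightarrow> complex" where "F 0 = 1"
    "hopping_operator g (\<lambda>m. if m \<ge> 0 then \<nu> else - \<nu>) F = (\<lambda>m. z * F m)"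
    "(\<lambda>n. F (int n)) \<longlonglongrightarrow> 0" "(\<lambda>n. F (- int n)) \<longlonglongrightarrow> 0"
proof -
  define k where "k = complex_of_real (exp g)"
  define l where "l = complex_of_real (exp (- g))"
  have k1: "exp g > 1" using g by simp
  have kl: "k * l = 1" "k \<noteq> 0" "l \<noteq> 0" "cmod l = 1 / cmod k" "cmod k = exp g"
    by (simp_all add: k_def l_def exp_minus inverse_eq_divide norm_divide)
  have sum_eq: "exp g + exp (- g) = exp g + 1 / exp g" by (simp add: exp_minus inverse_eq_divide)
  obtain u where u: "u \<noteq> 0" "u + 1 / u = z - \<nu>" "cmod u \<ge> 1" by (rule joukowski_surj)
  have "cmod u < exp g"
    using inside joukowski_foci[OF u(1)] add_inverse_less_iff[OF u(3) k1] unfolding u(2) sum_eq by simp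
  moreover have "cmod (l * u) = cmod u / exp g" "cmod (l / u) = 1 / (exp g * cmod u)"
    using kl by (simp_all add: norm_mult norm_divide)
  moreover have "exp g * cmod u > 1" using mult_less_le_imp_less[of 1 "exp g" 1 "cmod u"] k1 u(3) by simp
  ultimately have x: "cmod (l * u) < 1" "cmod (l / u) < 1" by simp_all
  obtain v where v: "v \<noteq> 0" "v + 1 / v = z + \<nu>" "cmod v \<ge> 1" by (rule joukowski_surj)
  have "cmod (v + 1 / v) \<le> cmod v + 1 / cmod v"
    using norm_triangle_ineq[of v "1 / v"] by (simp add: norm_divide)
  then have v_sum: "exp g + 1 / exp g < cmod v + 1 / cmod v" using outside v(2) sum_eq by simp
  have "cmod v \<noteq> exp g" using v_sum by auto
  moreover have "\<not> cmod v < exp g" using v_sum add_inverse_less_iff[OF v(3) k1] by simp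
  ultimately have "exp g < cmod v" by simp
  then have v': "cmod (k / v) < 1" using kl v(1) by (simp add: norm_divide divide_less_eq)
  obtain s where s: "s 0 = k / v" "s 1 = 1"
    "\<And>n. s (n + 2) = (l * u + l / u) * s (n + 1) - (l * u) * (l / u) * s n" "s \<longlonglongrightarrow> 0"
    using second_order_recurrence_tendsto_0[OF x] by blast
  \<comment> \<open>The index of \<open>s\<close> is shifted by one, so that \<open>s 0\<close> is the value at \<open>-1\<close> and the recurrence
    for \<open>s\<close> starts with the equation at \<open>m = 0\<close>.\<close>
  define F where "F m = (if m \<ge> 0 then s (nat (m + 1)) else (k / v) ^ nat (- m))" for m :: int
  have F_nonneg: "F (int n) = s (n + 1)" for n by (simp add: F_def nat_add_distrib)
  have F_neg: "F (- int n) = (k / v) ^ n" for n using s by (cases n) (auto simp: F_def nat_add_distrib)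
  have "l * F (m - 1) + k * F (m + 1) + (if m \<ge> 0 then \<nu> else - \<nu>) * F m = z * F m" for m
  proof (cases "m \<ge> 0")
    case True
    then obtain n where m: "m = int n" using nonneg_int_cases by blast
    have "F (m - 1) = s n"
    proof (cases n)
      case 0
      then show ?thesis using F_neg[of 1] s(1) by (simp add: m)
    next
      case (Suc j)
      then show ?thesis using F_nonneg[of j] by (simp add: m)
    qed
    moreover have "F (m + 1) = s (n + 2)" "F m = s (n + 1)"
      using F_nonneg[of "n + 1"] F_nonneg[of n] by (simp_all add: m add.commute)
    moreover have "k * (l * u + l / u) = z - \<nu>"
      unfolding u(2)[symmetric] using kl(1) by (simp add: distrib_left flip: mult.assoc)
    moreover have "k * ((l * u) * (l / u)) = l" using kl(1) u(1) by (simp flip: mult.assoc)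
    ultimately have "k * s (n + 2) = (z - \<nu>) * s (n + 1) - l * s n"
      unfolding s(3) right_diff_distrib mult.assoc[symmetric] by metis
    note step = \<open>F (m - 1) = s n\<close> \<open>F (m + 1) = s (n + 2)\<close> \<open>F m = s (n + 1)\<close> this
    show ?thesis unfolding step(1-3) using step(4) True by (simp add: left_diff_distrib)
  next
    case False
    then obtain n where m: "m = - int (Suc n)" by (cases m) auto
    define y where "y = k / v"
    have "F (m - 1) = y ^ (n + 2)" "F m = y ^ (n + 1)" "F (m + 1) = y ^ n"
      using F_neg[of "n + 2"] F_neg[of "n + 1"] F_neg[of n] by (simp_all add: m y_def)
    moreover have "l * y ^ 2 + k = (z + \<nu>) * y"
      unfolding v(2)[symmetric] y_def using kl v(1) by (simp add: field_simps power2_eq_square)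
    then have "y ^ n * (l * y ^ 2 + k) = y ^ n * ((z + \<nu>) * y)" by simp
    ultimately show ?thesis using False by (simp add: algebra_simps power2_eq_square)
  qed
  then have "hopping_operator g (\<lambda>m. if m \<ge> 0 then \<nu> else - \<nu>) F = (\<lambda>m. z * F m)"
    by (simp add: hopping_operator_def k_def l_def)
  moreover have "F 0 = 1" using F_neg[of 0] by simp
  moreover have "(\<lambda>n. F (int n)) \<longlonglongrightarrow> 0"
    unfolding F_nonneg using s(4) by (rule LIMSEQ_ignore_initial_segment)
  moreover have "(\<lambda>n. F (- int n)) \<longlonglongrightarrow> 0"
    unfolding F_neg using v' by (intro LIMSEQ_power_zero)
  ultimately show thesis using that by blast
qed

section \<open>Bounds for the hopping operator\<close>

lemma l2Z_finite_support:
  assumes "finite X" "\<And>m. m \<notin> X \<Longrightarrow> f m = 0" "\<And>m. cmod (f m) \<le> b"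
  shows "f \<in> l2Z" and "l2Z_norm f \<le> real (card X) * b"
proof -
  have "L2_set (\<lambda>m. cmod (f m)) F \<le> real (card X) * b" if F: "finite F" for F
  proof -
    have "L2_set (\<lambda>m. cmod (f m)) F \<le> (\<Sum>m\<in>F. cmod (f m))" by (rule L2_set_le_sum) simp
    also have "\<dots> = (\<Sum>m\<in>F \<inter> X. cmod (f m))"
      using F assms(2) by (intro sum.mono_neutral_right) auto
    also have "\<dots> \<le> (\<Sum>m\<in>X. cmod (f m))"
      using assms(1) by (intro sum_mono2) auto
    also have "\<dots> \<le> real (card X) * b" by (intro sum_bounded_above assms)
    finally show ?thesis .
  qed
  from l2Z_boundedI[OF this] show "f \<in> l2Z" "l2Z_norm f \<le> real (card X) * b" by blast+
qed

lemma hopping_operator_free_l2Z: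
  assumes f: "f \<in> l2Z"
  shows "hopping_operator g (\<lambda>_. 0) f \<in> l2Z"
    and "l2Z_norm (hopping_operator g (\<lambda>_. 0) f) \<le> (exp g + exp (- g)) * l2Z_norm f"
proof -
  have split: "hopping_operator g (\<lambda>_. 0) f =
      (\<lambda>m. of_real (exp (- g)) * f (m + (- 1)) + of_real (exp g) * f (m + 1))"
    by (simp add: hopping_operator_def)
  have shifts: "(\<lambda>m. f (m + (- 1))) \<in> l2Z" "(\<lambda>m. f (m + 1)) \<in> l2Z"
    using f by (simp_all only: l2Z_shift)
  show "hopping_operator g (\<lambda>_. 0) f \<in> l2Z"
    unfolding split by (intro l2Z_add l2Z_scale shifts)
  have "l2Z_norm (hopping_operator g (\<lambda>_. 0) f)
      \<le> l2Z_norm (\<lambda>m. of_real (exp (- g)) * f (m + (- 1))) + l2Z_norm (\<lambda>m. of_real (exp g) * f (m + 1))"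
    unfolding split by (intro l2Z_add l2Z_scale shifts)
  also have "\<dots> \<le> cmod (of_real (exp (- g))) * l2Z_norm f + cmod (of_real (exp g)) * l2Z_norm f"
    using l2Z_scale(2)[OF shifts(1), of "of_real (exp (- g))"]
      l2Z_scale(2)[OF shifts(2), of "of_real (exp g)"]
    unfolding l2Z_shift by (rule add_mono)
  finally show "l2Z_norm (hopping_operator g (\<lambda>_. 0) f) \<le> (exp g + exp (- g)) * l2Z_norm f"
    by (simp add: algebra_simps)
qed

lemma hopping_operator_split:
  "hopping_operator g V f = (\<lambda>m. hopping_operator g (\<lambda>_. 0) f m + V m * f m)"
  by (simp add: hopping_operator_def)

lemma hopping_operator_l2Z:
  assumes "f \<in> l2Z" "\<And>m. cmod (V m) \<le> B"
  shows "hopping_operator g V f \<in> l2Z"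
    and "l2Z_norm (hopping_operator g V f) \<le> (exp g + exp (- g) + B) * l2Z_norm f"
proof -
  note A = hopping_operator_free_l2Z[OF assms(1), of g]
  note P = l2Z_mult_bounded[of f V B, OF assms]
  show "hopping_operator g V f \<in> l2Z"
    unfolding hopping_operator_split[of g V] by (intro l2Z_add A P)
  have "l2Z_norm (hopping_operator g V f) \<le> l2Z_norm (hopping_operator g (\<lambda>_. 0) f) + l2Z_norm (\<lambda>m. V m * f m)"
    unfolding hopping_operator_split[of g V] by (intro l2Z_add A P)
  with A(2) P(2) show "l2Z_norm (hopping_operator g V f) \<le> (exp g + exp (- g) + B) * l2Z_norm f"
    by (simp add: distrib_right)
qed

lemma hopping_operator_contraction_not_in_spectrum:
  fixes p :: "int \<Rightarrow> complex"
  assumes V: "\<And>m. cmod (V m) \<le> B"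
    and p: "\<And>m. p m \<noteq> 0" "\<And>m. cmod (p m) \<le> P"
    and q: "0 \<le> q" "q < 1"
    and contr: "\<And>f. f \<in> l2Z \<Longrightarrow>
      l2Z_norm (\<lambda>m. f m - p m * (hopping_operator g V f m - z * f m)) \<le> q * l2Z_norm f"
  shows "z \<notin> spectrum_l2Z (hopping_operator g V)"
proof (rule preconditioned_contraction_not_in_spectrum[OF _ _ _ _ p q contr])
  show "hopping_operator g V f \<in> l2Z" if "f \<in> l2Z" for f
    by (rule hopping_operator_l2Z(1)[OF that V])
  show "(\<lambda>n. hopping_operator g V (F n) m) \<longlonglongrightarrow> hopping_operator g V f m"
    if "\<And>j. (\<lambda>n. F n j) \<longlonglongrightarrow> f j" for F :: "nat \<Rightarrow> int \<Rightarrow> complex" and f m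
    unfolding hopping_operator_def by (intro tendsto_intros that)
qed (simp_all add: hopping_operator_def algebra_simps)

text \<open>Dividing \<open>H - z\<close> by its diagonal \<open>V - z\<close> leaves the identity plus a perturbation of norm at most
  \<open>(e\<^sup>g + e\<^bsup>-g\<^esup>) / d < 1\<close>.\<close>

lemma hopping_far_from_potential_not_in_spectrum:
  assumes V: "\<And>m. cmod (V m) \<le> B"
    and d: "d > exp g + exp (- g)" "\<And>m. cmod (V m - z) \<ge> d"
  shows "z \<notin> spectrum_l2Z (hopping_operator g V)"
proof -
  have d0: "d > 0" using d(1) exp_gt_zero[of g] exp_gt_zero[of "- g"] by linarith
  have V_ne: "V m - z \<noteq> 0" for m using d(2)[of m] d0 by auto
  have p_le: "cmod (1 / (V m - z)) \<le> 1 / d" for m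
    using d(2)[of m] d0 by (simp add: norm_divide frac_le)
  show ?thesis
  proof (rule hopping_operator_contraction_not_in_spectrum[OF V _ p_le])
    show "1 / (V m - z) \<noteq> 0" for m using V_ne by simp
    show "0 \<le> (exp g + exp (- g)) / d" using d0 by (simp add: add_nonneg_nonneg)
    show "(exp g + exp (- g)) / d < 1" using d0 d(1) by simp
    fix f assume f: "f \<in> l2Z"
    note A = hopping_operator_free_l2Z[OF f, of g]
    have "f m - 1 / (V m - z) * (hopping_operator g V f m - z * f m)
        = (- 1 / (V m - z)) * hopping_operator g (\<lambda>_. 0) f m" for m
      unfolding hopping_operator_split[of g V] using V_ne[of m] by (simp add: field_simps)
    then have "l2Z_norm (\<lambda>m. f m - 1 / (V m - z) * (hopping_operator g V f m - z * f m))
        = l2Z_norm (\<lambda>m. (- 1 / (V m - z)) * hopping_operator g (\<lambda>_. 0) f m)"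
      by simp
    also have "\<dots> \<le> 1 / d * l2Z_norm (hopping_operator g (\<lambda>_. 0) f)"
      using p_le by (intro l2Z_mult_bounded A) (simp add: norm_divide)
    also have "\<dots> \<le> 1 / d * ((exp g + exp (- g)) * l2Z_norm f)"
      using A(2) d0 by (intro mult_left_mono) auto
    finally show "l2Z_norm (\<lambda>m. f m - 1 / (V m - z) * (hopping_operator g V f m - z * f m))
        \<le> (exp g + exp (- g)) / d * l2Z_norm f" by simp
  qed
qed

section \<open>The spectrum for a pseudo-ergodic potential\<close>

text \<open>Cutting \<open>F\<close> off outside \<open>[-N, N]\<close> violates the eigenvalue equation only at the four sites
  \<open>\<plusminus> N\<close> and \<open>\<plusminus> (N + 1)\<close>, with an error governed by values of \<open>F\<close> at distance \<open>N\<close> or more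
  from the origin. Thus decay of \<open>F\<close> at infinity suffices, and the value \<open>F 0 = 1\<close> keeps
  the norm of the truncation away from zero.\<close>

lemma truncated_eigenvector:
  assumes match: "\<And>S. finite S \<Longrightarrow> \<exists>k. \<forall>m\<in>S. V (m + k) = W m"
    and F: "F 0 = 1" "hopping_operator g W F = (\<lambda>m. z * F m)"
    and decay: "(\<lambda>n. F (int n)) \<longlonglongrightarrow> 0" "(\<lambda>n. F (- int n)) \<longlonglongrightarrow> 0"
    and \<epsilon>: "\<epsilon> > 0"
  shows "\<exists>f\<in>l2Z. l2Z_norm f \<ge> 1 \<and> (\<lambda>m. hopping_operator g V f m - z * f m) \<in> l2Z \<and>
      l2Z_norm (\<lambda>m. hopping_operator g V f m - z * f m) \<le> \<epsilon>"
proof -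
  define c where "c = exp g + exp (- g)"
  have c: "c > 0" by (simp add: c_def add_pos_pos)
  \<comment> \<open>Each of the four errors is at most \<open>c * \<eta>\<close>.\<close>
  define \<eta> where "\<eta> = \<epsilon> / (4 * c)"
  have \<eta>: "\<eta> > 0" using \<epsilon> c by (simp add: \<eta>_def)
  have "\<forall>\<^sub>F n in sequentially. cmod (F (int n)) < \<eta> \<and> cmod (F (- int n)) < \<eta>"
    using tendstoD[OF decay(1) \<eta>] tendstoD[OF decay(2) \<eta>] by (simp add: eventually_conj)
  then obtain N where N: "\<And>n. n \<ge> N \<Longrightarrow> cmod (F (int n)) < \<eta> \<and> cmod (F (- int n)) < \<eta>"
    by (auto simp: eventually_sequentially)
  have small: "cmod (F m) \<le> \<eta>" if "\<bar>m\<bar> \<ge> int N" for m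
  proof -
    have "N \<le> nat \<bar>m\<bar>" using that by linarith
    from N[OF this] show ?thesis by (cases "m \<ge> 0") auto
  qed
  obtain k where "\<forall>m\<in>{- int N..int N}. V (m + k) = W m"
    using match[of "{- int N..int N}"] by auto
  then have k: "V (m + k) = W m" if "\<bar>m\<bar> \<le> int N" for m
    by (rule bspec) (use that in arith)
  define G where "G m = (if \<bar>m\<bar> \<le> int N then F m else 0)" for m
  define r where "r m = hopping_operator g W G m - z * G m" for m
  define X where "X = {- int N - 1, - int N, int N, int N + 1}"
  have inner: "r m = of_real (exp (- g)) * (G (m - 1) - F (m - 1)) + of_real (exp g) * (G (m + 1) - F (m + 1))"
    if "\<bar>m\<bar> \<le> int N" for m
    using fun_cong[OF F(2), of m] that
    by (simp add: r_def hopping_operator_def G_def[of m] algebra_simps)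
  have outer: "r m = of_real (exp (- g)) * G (m - 1) + of_real (exp g) * G (m + 1)"
    if "\<not> \<bar>m\<bar> \<le> int N" for m
    using that by (simp add: r_def hopping_operator_def G_def[of m])
  have r_X: "r m = 0" if "m \<notin> X" for m
    using that by (cases "\<bar>m\<bar> \<le> int N") (auto simp: inner outer G_def X_def)
  have comb: "cmod (of_real (exp (- g)) * a + of_real (exp g) * b) \<le> c * \<eta>"
    if "cmod a \<le> \<eta>" "cmod b \<le> \<eta>" for a b
  proof -
    have "cmod (of_real (exp (- g)) * a + of_real (exp g) * b) \<le> exp (- g) * cmod a + exp g * cmod b"
      using norm_triangle_ineq[of "of_real (exp (- g)) * a" "of_real (exp g) * b"]
      by (simp add: norm_mult)
    also have "\<dots> \<le> exp (- g) * \<eta> + exp g * \<eta>" by (intro add_mono mult_left_mono that) auto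
    finally show ?thesis by (simp add: c_def algebra_simps)
  qed
  have r_le: "cmod (r m) \<le> c * \<eta>" for m
  proof (cases "\<bar>m\<bar> \<le> int N")
    case True
    show ?thesis unfolding inner[OF True] using \<eta> by (intro comb) (auto simp: G_def intro!: small)
  next
    case False
    show ?thesis unfolding outer[OF False] using \<eta> False by (intro comb) (auto simp: G_def intro!: small)
  qed
  have "real (card X) * (c * \<eta>) \<le> 4 * (c * \<eta>)"
    using c \<eta> card_length[of "[- int N - 1, - int N, int N, int N + 1]"]
    by (intro mult_right_mono) (auto simp: X_def)
  also have "\<dots> = \<epsilon>" using c by (simp add: \<eta>_def)
  finally have r: "r \<in> l2Z" "l2Z_norm r \<le> \<epsilon>"
    using l2Z_finite_support[of X r, OF _ r_X r_le] by (auto simp: X_def)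
  define f where "f m = G (m + (- k))" for m
  have "(\<lambda>m. (cmod (G m))\<^sup>2) summable_on UNIV"
    by (rule finite_nonzero_values_imp_summable_on)
       (rule finite_subset[of _ "{- int N..int N}"], auto simp: G_def split: if_splits)
  then have f_l2: "f \<in> l2Z" unfolding f_def l2Z_shift by (simp add: l2Z_def)
  have residual: "(\<lambda>m. hopping_operator g V f m - z * f m) = (\<lambda>m. r (m + (- k)))"
  proof
    fix m
    have "V m * G (m - k) = W (m - k) * G (m - k)"
      using k[of "m - k"] by (simp add: G_def)
    then show "hopping_operator g V f m - z * f m = r (m + (- k))"
      by (simp add: r_def hopping_operator_def f_def algebra_simps)
  qed
  have "1 \<le> l2Z_norm f" using norm_le_l2Z_norm[OF f_l2, of k] F(1) by (simp add: f_def G_def)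
  moreover have "(\<lambda>m. hopping_operator g V f m - z * f m) \<in> l2Z"
      "l2Z_norm (\<lambda>m. hopping_operator g V f m - z * f m) \<le> \<epsilon>"
    unfolding residual l2Z_shift using r by auto
  ultimately show ?thesis using f_l2 by (intro bexI[of _ f]) auto
qed

text \<open>The two values are at distance \<open>2 \<bar>\<nu>\<bar>\<close>, so an approximation within \<open>\<bar>\<nu>\<bar>\<close> is exact.\<close>

lemma pseudo_ergodic_two_values:
  assumes V: "pseudo_ergodic {\<nu>, - \<nu>} V" and \<nu>: "\<nu> \<noteq> 0"
    and W: "range W \<subseteq> {\<nu>, - \<nu>}" and S: "finite S"
  shows "\<exists>k. \<forall>m\<in>S. V (m + k) = W m"
proof -
  have V_range: "V j \<in> {\<nu>, - \<nu>}" for j using V unfolding pseudo_ergodic_def by blast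
  have "cmod \<nu> > 0" "W ` S \<subseteq> {\<nu>, - \<nu>}" using \<nu> W by auto
  with V S obtain k where k: "\<And>m. m \<in> S \<Longrightarrow> cmod (W m - V (m + k)) < cmod \<nu>"
    unfolding pseudo_ergodic_def by meson
  have "V (m + k) = W m" if "m \<in> S" for m
  proof (rule ccontr)
    assume "V (m + k) \<noteq> W m"
    moreover have "W m \<in> {\<nu>, - \<nu>}" using W by auto
    ultimately have "W m - V (m + k) = 2 * \<nu> \<or> W m - V (m + k) = - (2 * \<nu>)"
      using V_range[of "m + k"] by auto
    then have "cmod (W m - V (m + k)) = 2 * cmod \<nu>" by (auto simp: norm_mult)
    with k[OF that] show False by simp
  qed
  then show ?thesis by blast
qed

text \<open>The step eigenvector exists only for \<open>w\<close> strictly inside the ellipse. For general \<open>w\<close> it is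
  used at \<open>(1 - t) w\<close> with \<open>t\<close> small: the centre \<open>0\<close> has focal distance sum
  \<open>4 < 2 (e\<^sup>g + e\<^bsup>-g\<^esup>)\<close>, so convexity makes the inequality for \<open>(1 - t) w\<close> strict, while the change of
  spectral parameter costs at most \<open>\<epsilon> / 2\<close>.\<close>

lemma shifted_hull_subset_hopping_spectrum:
  assumes g: "g > 0" and \<nu>: "cmod \<nu> > exp g + exp (- g)"
    and V: "pseudo_ergodic {\<nu>, - \<nu>} V"
    and w: "w \<in> closed_convex_hull (hopping_ellipse g)"
  shows "w + \<nu> \<in> spectrum_l2Z (hopping_operator g V)"
proof (rule approximate_eigenvectors_in_spectrum)
  fix \<epsilon> :: real
  assume \<epsilon>: "\<epsilon> > 0"
  define c where "c = exp g + exp (- g)"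
  have c: "c > 2" using add_inverse_less_iff[of 1 "exp g"] g by (simp add: c_def exp_minus inverse_eq_divide)
  have foci: "cmod (w - 2) + cmod (w + 2) \<le> 2 * c"
    using closed_convex_hull_ellipse_foci[OF w] by (simp add: c_def)
  have "2 * cmod w \<le> cmod (w - 2) + cmod (w + 2)"
    using norm_triangle_ineq[of "w - 2" "w + 2"] by (simp flip: mult_2 add: norm_mult)
  then have w_le: "cmod w \<le> c" using foci by simp
  \<comment> \<open>The denominator exceeds both \<open>\<epsilon>\<close> and \<open>2 * cmod w\<close>, as the two bounds on \<open>t\<close> demand.\<close>
  define t where "t = \<epsilon> / (2 * (cmod w + 1 + \<epsilon>))"
  have pos: "cmod w + 1 + \<epsilon> > 0" using \<epsilon> by (simp add: add_nonneg_pos)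
  have t: "0 < t" "t < 1" "t * cmod w \<le> \<epsilon> / 2"
  proof -
    show "0 < t" using pos \<epsilon> by (simp add: t_def)
    have "\<epsilon> < 2 * (cmod w + 1 + \<epsilon>)" using pos \<epsilon> norm_ge_zero[of w] by argo
    then show "t < 1" using pos unfolding t_def by (subst divide_less_eq_1_pos) auto
    have "\<epsilon> * cmod w \<le> \<epsilon> * (cmod w + 1 + \<epsilon>)" using \<epsilon> by (intro mult_left_mono) auto
    then show "t * cmod w \<le> \<epsilon> / 2" using pos by (simp add: t_def field_simps)
  qed
  define z where "z = of_real (1 - t) * w + \<nu>"
  have inside: "cmod (z - \<nu> - 2) + cmod (z - \<nu> + 2) < 2 * c"
  proof -
    have "z - \<nu> - 2 = of_real (1 - t) * (w - 2) + of_real t * (- 2)"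
      "z - \<nu> + 2 = of_real (1 - t) * (w + 2) + of_real t * 2"
      by (simp_all add: z_def algebra_simps)
    then have "cmod (z - \<nu> - 2) \<le> cmod (of_real (1 - t) * (w - 2)) + cmod (of_real t * (- 2))"
      "cmod (z - \<nu> + 2) \<le> cmod (of_real (1 - t) * (w + 2)) + cmod (of_real t * 2)"
      by (simp_all only: norm_triangle_ineq)
    then have "cmod (z - \<nu> - 2) + cmod (z - \<nu> + 2) \<le> (1 - t) * (cmod (w - 2) + cmod (w + 2)) + t * 4"
      unfolding norm_mult norm_of_real using t by (simp add: distrib_left)
    also have "\<dots> \<le> (1 - t) * (2 * c) + t * 4" using foci t by (intro add_right_mono mult_left_mono) auto
    also have "\<dots> < 2 * c" using mult_strict_left_mono[OF c t(1)] by (simp add: algebra_simps)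
    finally show ?thesis .
  qed
  have outside: "cmod (z + \<nu>) > c"
  proof -
    have "cmod (of_real (1 - t) * w) \<le> 1 * cmod w"
      unfolding norm_mult norm_of_real using t by (intro mult_right_mono) auto
    moreover have "z + \<nu> = 2 * \<nu> + of_real (1 - t) * w" by (simp add: z_def)
    then have "cmod (z + \<nu>) \<ge> cmod (2 * \<nu>) - cmod (of_real (1 - t) * w)"
      by (simp only: norm_diff_ineq)
    ultimately show ?thesis using w_le \<nu> by (simp add: norm_mult c_def)
  qed
  define W where "W m = (if m \<ge> 0 then \<nu> else - \<nu>)" for m :: int
  obtain F where F: "F 0 = 1" "hopping_operator g W F = (\<lambda>m. z * F m)"
      "(\<lambda>n. F (int n)) \<longlonglongrightarrow> 0" "(\<lambda>n. F (- int n)) \<longlonglongrightarrow> 0"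
    using decaying_solution[OF g, of z \<nu>] inside outside unfolding c_def W_def by blast
  have "c > 0" using c by simp
  then have "\<nu> \<noteq> 0" using \<nu> by (auto simp: c_def)
  then have match: "\<exists>k. \<forall>m\<in>S. V (m + k) = W m" if "finite S" for S
    using that V by (intro pseudo_ergodic_two_values) (auto simp: W_def)
  obtain f where f: "f \<in> l2Z" "l2Z_norm f \<ge> 1" "(\<lambda>m. hopping_operator g V f m - z * f m) \<in> l2Z"
      "l2Z_norm (\<lambda>m. hopping_operator g V f m - z * f m) \<le> \<epsilon> / 2"
    using truncated_eigenvector[OF match F, of "\<epsilon> / 2"] \<epsilon> by auto
  have split: "(\<lambda>m. hopping_operator g V f m - (w + \<nu>) * f m)
      = (\<lambda>m. (hopping_operator g V f m - z * f m) + (- (of_real t * w)) * f m)"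
    by (simp add: z_def algebra_simps fun_eq_iff)
  have "l2Z_norm (\<lambda>m. hopping_operator g V f m - (w + \<nu>) * f m)
      \<le> l2Z_norm (\<lambda>m. hopping_operator g V f m - z * f m) + l2Z_norm (\<lambda>m. (- (of_real t * w)) * f m)"
    unfolding split by (intro l2Z_add l2Z_scale f)
  also have "\<dots> \<le> \<epsilon> / 2 * 1 + cmod (- (of_real t * w)) * l2Z_norm f"
    using f(4) by (intro add_mono l2Z_scale f) simp
  also have "\<dots> \<le> \<epsilon> / 2 * l2Z_norm f + \<epsilon> / 2 * l2Z_norm f"
    using t \<epsilon> f(2) l2Z_norm_nonneg[of f] by (intro add_mono mult_left_mono mult_right_mono) (auto simp: norm_mult)
  finally have le: "l2Z_norm (\<lambda>m. hopping_operator g V f m - (w + \<nu>) * f m) \<le> \<epsilon> * l2Z_norm f"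
    by simp
  have "(\<lambda>m. hopping_operator g V f m - (w + \<nu>) * f m) \<in> l2Z"
    unfolding split by (intro l2Z_add l2Z_scale f)
  with le f show "\<exists>f\<in>l2Z. l2Z_norm f > 0 \<and> (\<lambda>m. hopping_operator g V f m - (w + \<nu>) * f m) \<in> l2Z \<and>
      l2Z_norm (\<lambda>m. hopping_operator g V f m - (w + \<nu>) * f m) \<le> \<epsilon> * l2Z_norm f"
    by (intro bexI[of _ f]) auto
qed

section \<open>The numerical range\<close>

lemma abs_Re_mult_cnj_le: "\<bar>Re (a * x * cnj y)\<bar> \<le> cmod a * ((cmod x)\<^sup>2 + (cmod y)\<^sup>2) / 2"
proof -
  have "\<bar>Re (a * x * cnj y)\<bar> \<le> cmod (a * x * cnj y)" by (rule abs_Re_le_cmod)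
  also have "\<dots> = cmod a * (cmod x * cmod y)" by (simp add: norm_mult)
  also have "\<dots> \<le> cmod a * (((cmod x)\<^sup>2 + (cmod y)\<^sup>2) / 2)"
    using sum_squares_bound[of "cmod x" "cmod y"] by (intro mult_left_mono) auto
  finally show ?thesis by simp
qed

text \<open>The real part of \<open>\<langle>c (H - z) f, f\<rangle>\<close> is bounded below by \<open>\<delta> \<parallel>f\<parallel>\<^sup>2\<close>. Indeed, up to a
  shift of the summation index, the two hopping terms combine to \<open>Re (\<kappa> f\<^bsub>m-1\<^esub> cnj f\<^bsub>m\<^esub>)\<close> with
  \<open>\<kappa> = c e\<^bsup>-g\<^esup> + cnj c e\<^sup>g\<close>, which sums to at least \<open>- \<bar>\<kappa>\<bar> \<parallel>f\<parallel>\<^sup>2\<close>. Expanding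
  \<open>\<parallel>f - \<tau> c (H - z) f\<parallel>\<^sup>2\<close> then gives the bound \<open>(1 - 2 \<tau> \<delta> + \<tau>\<^sup>2 K\<^sup>2) \<parallel>f\<parallel>\<^sup>2\<close>, where \<open>K\<close> bounds
  the norm of \<open>c (H - z)\<close>.\<close>

lemma hopping_half_plane_not_in_spectrum:
  fixes c z :: complex
  assumes V: "\<And>m. cmod (V m) \<le> B" and \<delta>: "\<delta> > 0"
    and sep: "\<And>m. Re (c * (V m - z)) \<ge> cmod (c * of_real (exp (- g)) + cnj c * of_real (exp g)) + \<delta>"
  shows "z \<notin> spectrum_l2Z (hopping_operator g V)"
proof -
  define \<kappa> where "\<kappa> = c * of_real (exp (- g)) + cnj c * of_real (exp g)"
  define k where "k = c * of_real (exp g)"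
  have "c \<noteq> 0" using sep[of 0] \<delta> by auto
  define K where "K = cmod c * (exp g + exp (- g) + B + cmod z) + 1"
  have B: "0 \<le> B" using V[of 0] norm_ge_zero order_trans by blast
  have K: "K > 0" unfolding K_def using B by (intro add_nonneg_pos mult_nonneg_nonneg add_nonneg_nonneg) auto
  \<comment> \<open>This value minimises \<open>1 - 2 * \<tau> * \<delta> + \<tau>\<^sup>2 * K\<^sup>2\<close>.\<close>
  define \<tau> where "\<tau> = \<delta> / K\<^sup>2"
  have \<tau>: "\<tau> > 0" using K \<delta> by (simp add: \<tau>_def)
  define q where "q = sqrt (1 - \<delta>\<^sup>2 / K\<^sup>2)"
  have "q < 1" using K \<delta> by (simp add: q_def)
  show ?thesis
  proof (rule hopping_operator_contraction_not_in_spectrum[OF V, where p = "\<lambda>_. of_real \<tau> * c"])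
    show "of_real \<tau> * c \<noteq> 0" using \<tau> \<open>c \<noteq> 0\<close> by simp
    show "cmod (of_real \<tau> * c) \<le> cmod (of_real \<tau> * c)" by simp
    \<comment> \<open>The maximum with \<open>0\<close> spares the comparison of \<open>\<delta>\<close> with \<open>K\<close>.\<close>
    show "0 \<le> max 0 q" "max 0 q < 1" using \<open>q < 1\<close> by auto
    fix f assume f: "f \<in> l2Z"
    define N where "N = l2Z_norm f"
    have N: "0 \<le> N" by (simp add: N_def l2Z_norm_nonneg)
    define b where "b m = c * (hopping_operator g V f m - z * f m)" for m
    have residual: "(\<lambda>m. hopping_operator g V f m - z * f m) \<in> l2Z"
      by (intro l2Z_diff_scaled f hopping_operator_l2Z(1)[OF f V])
    then have b: "b \<in> l2Z" unfolding b_def by (rule l2Z_scale)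
    have b_norm: "l2Z_norm b \<le> K * N"
    proof -
      note H = hopping_operator_l2Z[OF f V, of g]
      have "l2Z_norm (\<lambda>m. hopping_operator g V f m - z * f m)
          \<le> l2Z_norm (hopping_operator g V f) + l2Z_norm (\<lambda>m. (- z) * f m)"
        using l2Z_add(2)[OF H(1) l2Z_scale(1)[OF f, of "- z"]] by simp
      also have "\<dots> \<le> (exp g + exp (- g) + B) * N + cmod (- z) * N"
        unfolding N_def by (intro add_mono H l2Z_scale f)
      finally have res: "l2Z_norm (\<lambda>m. hopping_operator g V f m - z * f m)
          \<le> (exp g + exp (- g) + B + cmod z) * N" by (simp add: algebra_simps)
      have "l2Z_norm b \<le> cmod c * l2Z_norm (\<lambda>m. hopping_operator g V f m - z * f m)"
        unfolding b_def by (rule l2Z_scale[OF residual])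
      also have "\<dots> \<le> cmod c * ((exp g + exp (- g) + B + cmod z) * N)"
        using res by (rule mult_left_mono) simp
      also have "\<dots> \<le> K * N" using N by (simp add: K_def algebra_simps)
      finally show ?thesis .
    qed
    \<comment> \<open>The index shift: the difference \<open>r (m + 1) - r m\<close> converts one hopping term into
      the conjugate of the other and sums to zero.\<close>
    define r where "r m = Re (k * f m * cnj (f (m - 1)))" for m
    have sum_f: "((\<lambda>m. (cmod (f m))\<^sup>2) has_sum N\<^sup>2) UNIV"
      unfolding N_def by (rule has_sum_l2Z_norm[OF f])
    have sum_f_shift: "((\<lambda>m. (cmod (f (m - 1)))\<^sup>2) has_sum N\<^sup>2) UNIV"
      using has_sum_reindex_bij_betw[OF bij_int_shift, of "\<lambda>m. (cmod (f m))\<^sup>2" "- 1" "N\<^sup>2"] sum_f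
      by simp
    have "r summable_on UNIV"
    proof (rule Infinite_Sum.abs_summable_summable, rule Infinite_Sum.abs_summable_on_comparison_test)
      note sum_both = has_sum_cmult_right[OF has_sum_add[OF sum_f sum_f_shift], of "cmod k / 2"]
      then show "(\<lambda>m. norm (cmod k / 2 * ((cmod (f m))\<^sup>2 + (cmod (f (m - 1)))\<^sup>2))) summable_on UNIV"
        by (simp add: has_sum_iff)
      show "norm (r m) \<le> norm (cmod k / 2 * ((cmod (f m))\<^sup>2 + (cmod (f (m - 1)))\<^sup>2))" for m
        using abs_Re_mult_cnj_le[of k "f m" "f (m - 1)"] by (simp add: r_def)
    qed
    then obtain s where sum_r: "(r has_sum s) UNIV" by (auto simp: summable_on_def)
    then have sum_r_shift: "((\<lambda>m. r (m + 1)) has_sum s) UNIV"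
      using has_sum_reindex_bij_betw[OF bij_int_shift, of r 1 s] by simp
    have form: "Re (b m * cnj (f m)) \<ge> - cmod \<kappa> * ((cmod (f (m - 1)))\<^sup>2 + (cmod (f m))\<^sup>2) / 2
        + (r (m + 1) - r m) + (cmod \<kappa> + \<delta>) * (cmod (f m))\<^sup>2" for m
    proof -
      have "b m * cnj (f m) = \<kappa> * f (m - 1) * cnj (f m) + (k * f (m + 1) * cnj (f m)
          - cnj k * f (m - 1) * cnj (f m)) + c * (V m - z) * (f m * cnj (f m))"
        by (simp add: b_def hopping_operator_def \<kappa>_def k_def algebra_simps)
      also have "f m * cnj (f m) = of_real ((cmod (f m))\<^sup>2)"
        by (simp only: complex_norm_square)
      finally have "Re (b m * cnj (f m)) = Re (\<kappa> * f (m - 1) * cnj (f m)) + (Re (k * f (m + 1) * cnj (f m))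
          - Re (cnj k * f (m - 1) * cnj (f m))) + Re (c * (V m - z)) * (cmod (f m))\<^sup>2"
        by (simp only: plus_complex.sel minus_complex.sel Re_complex_of_real Im_complex_of_real times_complex.sel mult_zero_right diff_0_right)
      moreover have "Re (cnj k * f (m - 1) * cnj (f m)) = r m"
        by (simp add: r_def algebra_simps)
      moreover have "Re (k * f (m + 1) * cnj (f m)) = r (m + 1)"
        by (simp add: r_def)
      moreover have "Re (\<kappa> * f (m - 1) * cnj (f m)) \<ge> - cmod \<kappa> * ((cmod (f (m - 1)))\<^sup>2 + (cmod (f m))\<^sup>2) / 2"
        using abs_Re_mult_cnj_le[of \<kappa> "f (m - 1)" "f m"] by linarith
      moreover have "Re (c * (V m - z)) * (cmod (f m))\<^sup>2 \<ge> (cmod \<kappa> + \<delta>) * (cmod (f m))\<^sup>2"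
        using sep[of m] unfolding \<kappa>_def by (rule mult_right_mono) simp
      ultimately show ?thesis by linarith
    qed
    define e where "e m = f m + (- of_real \<tau>) * b m" for m
    have e: "e \<in> l2Z" unfolding e_def by (intro l2Z_add l2Z_scale f b)
    have pointwise: "(cmod (e m))\<^sup>2 \<le> (1 - \<tau> * cmod \<kappa> - 2 * \<tau> * \<delta>) * (cmod (f m))\<^sup>2
        + \<tau> * cmod \<kappa> * (cmod (f (m - 1)))\<^sup>2 + ((- 2 * \<tau>) * r (m + 1) + 2 * \<tau> * r m) + \<tau>\<^sup>2 * (cmod (b m))\<^sup>2" for m
    proof -
      have "(cmod (e m))\<^sup>2 = (cmod (f m))\<^sup>2 - 2 * \<tau> * Re (b m * cnj (f m)) + \<tau>\<^sup>2 * (cmod (b m))\<^sup>2"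
        unfolding e_def cmod_power2 by (simp add: power2_eq_square algebra_simps)
      also have "\<dots> \<le> (cmod (f m))\<^sup>2 - 2 * \<tau> * (- cmod \<kappa> * ((cmod (f (m - 1)))\<^sup>2 + (cmod (f m))\<^sup>2) / 2
        + (r (m + 1) - r m) + (cmod \<kappa> + \<delta>) * (cmod (f m))\<^sup>2) + \<tau>\<^sup>2 * (cmod (b m))\<^sup>2"
        using form[of m] \<tau> by (intro add_mono diff_mono mult_left_mono) auto
      finally show ?thesis by (simp add: field_simps)
    qed
    have "(l2Z_norm e)\<^sup>2 \<le> (1 - \<tau> * cmod \<kappa> - 2 * \<tau> * \<delta>) * N\<^sup>2
        + \<tau> * cmod \<kappa> * N\<^sup>2 + ((- 2 * \<tau>) * s + 2 * \<tau> * s) + \<tau>\<^sup>2 * (l2Z_norm b)\<^sup>2"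
      by (rule has_sum_mono[OF has_sum_l2Z_norm[OF e] _ pointwise])
         (intro has_sum_add has_sum_cmult_right sum_f sum_f_shift sum_r sum_r_shift has_sum_l2Z_norm b)
    also have "\<dots> = (1 - 2 * \<tau> * \<delta>) * N\<^sup>2 + \<tau>\<^sup>2 * (l2Z_norm b)\<^sup>2" by (simp add: algebra_simps)
    also have "\<dots> \<le> (1 - 2 * \<tau> * \<delta>) * N\<^sup>2 + \<tau>\<^sup>2 * (K * N)\<^sup>2"
      using b_norm l2Z_norm_nonneg[of b] by (intro add_left_mono mult_left_mono power_mono) auto
    also have "\<dots> = (1 - \<delta>\<^sup>2 / K\<^sup>2) * N\<^sup>2"
      using K by (simp add: \<tau>_def field_simps power2_eq_square)
    finally have "sqrt ((l2Z_norm e)\<^sup>2) \<le> sqrt ((1 - \<delta>\<^sup>2 / K\<^sup>2) * N\<^sup>2)"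
      by (rule real_sqrt_le_mono)
    then have "l2Z_norm e \<le> q * N"
      using N l2Z_norm_nonneg[of e] by (simp add: q_def real_sqrt_mult)
    also have "\<dots> \<le> max 0 q * N" using N by (intro mult_right_mono) auto
    finally show "l2Z_norm (\<lambda>m. f m - of_real \<tau> * c * (hopping_operator g V f m - z * f m))
        \<le> max 0 q * l2Z_norm f"
      by (simp add: e_def[abs_def] b_def N_def mult.assoc)
  qed
qed

text \<open>The quantity \<open>\<bar>\<kappa>\<bar>\<close> from the preceding lemma is the support function of the ellipse, so that
  lemma is sharp enough for every supporting line. The minimum of \<open>Re (c e)\<close> is attained where the phase of \<open>u\<close>
  is opposite to that of \<open>\<kappa>\<close>.\<close>

lemma hopping_ellipse_support_point:
  fixes c :: complex
  obtains e where "e \<in> hopping_ellipse g"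
    "Re (c * e) = - cmod (c * of_real (exp (- g)) + cnj c * of_real (exp g))"
proof -
  define \<kappa> where "\<kappa> = c * of_real (exp (- g)) + cnj c * of_real (exp g)"
  define \<omega> where "\<omega> = (if \<kappa> = 0 then 1 else - sgn \<kappa>)"
  have \<omega>: "cmod \<omega> = 1" by (simp add: \<omega>_def norm_sgn)
  define u where "u = of_real (exp g) * \<omega>"
  have "u \<in> {u. cmod u = exp g}" using \<omega> by (simp add: u_def norm_mult)
  then have "u + 1 / u \<in> hopping_ellipse g" unfolding hopping_ellipse_eq_joukowski_image by (rule imageI)
  moreover have "1 / u = of_real (exp (- g)) * cnj \<omega>"
  proof -
    have "\<omega> * cnj \<omega> = 1" using complex_norm_square[of \<omega>] \<omega> by simp
    moreover have "complex_of_real (exp g) * of_real (exp (- g)) = 1"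
      by (simp flip: of_real_mult exp_add)
    ultimately have "u * (of_real (exp (- g)) * cnj \<omega>) = 1"
      unfolding u_def by (metis mult.assoc mult.commute mult_1)
    then show ?thesis by (metis div_by_1 divide_divide_eq_right eq_divide_imp mult.commute mult_zero_left zero_neq_one)
  qed
  moreover have "Re (c * (of_real (exp g) * \<omega> + of_real (exp (- g)) * cnj \<omega>)) = Re (\<kappa> * cnj \<omega>)"
    by (simp add: \<kappa>_def algebra_simps)
  moreover have "Re (\<kappa> * cnj \<omega>) = - cmod \<kappa>"
  proof (cases "\<kappa> = 0")
    case False
    have "\<kappa> * cnj (sgn \<kappa>) = of_real (cmod \<kappa>)"
      using False complex_norm_square[of \<kappa>] by (simp add: sgn_div_norm scaleR_conv_of_real power2_eq_square field_simps)
    then show ?thesis using False by (simp add: \<omega>_def)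
  qed simp
  ultimately show thesis using that[of "u + 1 / u"] by (simp add: u_def \<kappa>_def)
qed

text \<open>A point outside the closed convex set on the right is strictly separated from it. Evaluating the
  separating functional at the sum of the extreme point of the ellipse and a value of the potential gives the
  hypothesis of the half-plane criterion, with \<open>\<delta>\<close> the gap of the separation.\<close>

lemma hopping_spectrum_subset_hull_plus_potential_hull:
  assumes V: "range V \<subseteq> complex_of_real ` I" and I: "convex I" "compact I"
  shows "spectrum_l2Z (hopping_operator g V) \<subseteq> closed_convex_hull (hopping_ellipse g) + of_real ` I"
proof
  fix z assume z: "z \<in> spectrum_l2Z (hopping_operator g V)"
  let ?E = "closed_convex_hull (hopping_ellipse g)"
  show "z \<in> ?E + of_real ` I"
  proof (rule ccontr)
    assume notin: "z \<notin> ?E + of_real ` I"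
    have comp: "compact (complex_of_real ` I)"
      using I(2) by (intro compact_continuous_image continuous_intros)
    have conv: "convex (complex_of_real ` I)"
      using I(1) by (intro convex_linear_image) (simp_all add: bounded_linear.linear bounded_linear_of_real)
    have "convex (?E + of_real ` I)"
      using conv by (intro convex_set_plus) (simp_all add: closed_convex_hull_def)
    moreover have "?E + of_real ` I = (\<Union>x\<in>?E. \<Union>y\<in>of_real ` I. {x + y})"
      by (auto simp: set_plus_def)
    then have "closed (?E + of_real ` I)"
      using closed_compact_sums[of ?E, OF _ comp] by (simp add: closed_convex_hull_def)
    ultimately obtain a \<beta> where sep: "a \<bullet> z < \<beta>" "\<And>x. x \<in> ?E + of_real ` I \<Longrightarrow> \<beta> < a \<bullet> x"
      using separating_hyperplane_closed_point[OF _ _ notin] by blast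
    define c where "c = cnj a"
    have inner: "a \<bullet> x = Re (c * x)" for x by (simp add: c_def inner_complex_def)
    obtain e where e: "e \<in> hopping_ellipse g"
        "Re (c * e) = - cmod (c * of_real (exp (- g)) + cnj c * of_real (exp g))"
      by (rule hopping_ellipse_support_point)
    have eE: "e \<in> ?E"
      unfolding closed_convex_hull_def using e(1) by (intro subsetD[OF closure_subset] hull_inc)
    have "Re (c * (V m - z)) \<ge> cmod (c * of_real (exp (- g)) + cnj c * of_real (exp g)) + (\<beta> - a \<bullet> z)" for m
    proof -
      have "e + V m \<in> ?E + of_real ` I" using eE V by (intro set_plus_intro) auto
      then have "\<beta> < Re (c * e) + Re (c * V m)" using sep(2)[of "e + V m"] by (simp add: inner distrib_left)
      then show ?thesis using e(2) by (simp add: inner right_diff_distrib)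
    qed
    moreover obtain B where "\<And>m. cmod (V m) \<le> B"
      using compact_imp_bounded[OF comp] V unfolding bounded_iff by blast
    ultimately have "z \<notin> spectrum_l2Z (hopping_operator g V)"
      using hopping_half_plane_not_in_spectrum[of V B "\<beta> - a \<bullet> z" c g z] sep(1) by simp
    with z show False by blast
  qed
qed

theorem theorem14:
  fixes g \<mu> :: real and V :: "int \<Rightarrow> complex"
  assumes "g > 0"
    and "\<mu> > exp g + exp (- g)"
    and "pseudo_ergodic {of_real \<mu>, - of_real \<mu>} V"
  shows "(closed_convex_hull (hopping_ellipse g) + {of_real \<mu>}) \<union>
           (closed_convex_hull (hopping_ellipse g) + {- of_real \<mu>})
           \<subseteq> spectrum_l2Z (hopping_operator g V) \<and>
         spectrum_l2Z (hopping_operator g V)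
           \<subseteq> cball (of_real \<mu>) (exp g + exp (- g)) \<union> cball (- of_real \<mu>) (exp g + exp (- g)) \<and>
         spectrum_l2Z (hopping_operator g V)
           \<subseteq> closed_convex_hull (hopping_ellipse g) + of_real ` {- \<mu>..\<mu>}"
proof (intro conjI Un_least)
  have V_range: "V m = of_real \<mu> \<or> V m = - of_real \<mu>" for m
    using assms(3) unfolding pseudo_ergodic_def by blast
  have \<mu>: "\<mu> > 0" using assms(2) exp_gt_zero[of g] exp_gt_zero[of "- g"] by linarith
  have big: "cmod (of_real \<mu>) > exp g + exp (- g)" "cmod (- of_real \<mu>) > exp g + exp (- g)"
    using assms(2) \<mu> by simp_all
  have V': "pseudo_ergodic {- of_real \<mu>, - (- of_real \<mu>)} V"
    using assms(3) by (simp add: insert_commute)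
  show "closed_convex_hull (hopping_ellipse g) + {of_real \<mu>} \<subseteq> spectrum_l2Z (hopping_operator g V)"
    using shifted_hull_subset_hopping_spectrum[OF assms(1) big(1) assms(3)]
    by (auto elim!: set_plus_elim)
  show "closed_convex_hull (hopping_ellipse g) + {- of_real \<mu>} \<subseteq> spectrum_l2Z (hopping_operator g V)"
    using shifted_hull_subset_hopping_spectrum[OF assms(1) big(2) V']
    by (auto elim!: set_plus_elim)
  show "spectrum_l2Z (hopping_operator g V)
      \<subseteq> cball (of_real \<mu>) (exp g + exp (- g)) \<union> cball (- of_real \<mu>) (exp g + exp (- g))"
  proof (rule subsetI, rule ccontr)
    fix z assume z: "z \<in> spectrum_l2Z (hopping_operator g V)"
      "z \<notin> cball (of_real \<mu>) (exp g + exp (- g)) \<union> cball (- of_real \<mu>) (exp g + exp (- g))"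
    define d where "d = min (cmod (of_real \<mu> - z)) (cmod (- of_real \<mu> - z))"
    have "d > exp g + exp (- g)" using z(2) by (simp add: d_def dist_norm)
    moreover have "cmod (V m - z) \<ge> d" for m using V_range[of m] by (auto simp: d_def)
    moreover have "cmod (V m) \<le> \<mu>" for m using V_range[of m] \<mu> by auto
    ultimately show False using hopping_far_from_potential_not_in_spectrum[of V \<mu> g d z] z(1) by blast
  qed
  have "complex_of_real \<mu> \<in> of_real ` {- \<mu>..\<mu>}"
    using \<mu> by (intro imageI) simp
  moreover have "complex_of_real (- \<mu>) \<in> of_real ` {- \<mu>..\<mu>}"
    using \<mu> by (intro imageI) simp
  ultimately have "range V \<subseteq> of_real ` {- \<mu>..\<mu>}"
    using V_range by (metis image_subsetI of_real_minus)
  from hopping_spectrum_subset_hull_plus_potential_hull[OF this]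
  show "spectrum_l2Z (hopping_operator g V)
      \<subseteq> closed_convex_hull (hopping_ellipse g) + of_real ` {- \<mu>..\<mu>}"
    by (simp only: convex_real_interval compact_Icc)
qed

end
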